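(* Let $X$ and $Y$ be two simple graphs, each on $n\ge 6$ vertices, such that $\delta(X)>n/2$, $\delta(Y)>n/2$, and $$2\min(\delta(X),\delta(Y))+3\max(\delta(X),\delta(Y))\ge 3n.$$ Then the friends-and-strangers graph $\mathsf{FS}(X,Y)$ is connected.
   Context: For a simple graph $G$, $\delta(G)$ denotes its minimum degree. For two simple graphs $X$ and $Y$ with the same finite number of vertices, the friends-and-strangers graph $\mathsf{FS}(X,Y)$ has as vertex set all bijections $\sigma:V(X)\to V(Y)$; two bijections $\sigma,\tau$ are adjacent if and only if there are distinct vertices $a,b\in V(X)$ with $\{a,b\}\in E(X)$, $\{\sigma(a),\sigma(b)\}\in E(Y)$, $\tau(a)=\sigma(b)$, $\tau(b)=\sigma(a)$, and $\tau(w)=\sigma(w)$ for all $w\in V(X)\setminus\{a,b\}$. *)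

theory Defs
  imports Complex_Main "HOL-Library.FuncSet" "Graph_Theory.Graph_Theory"
begin

text \<open>
  A finite simple graph is a \<^locale>\<open>pair_graph\<close>: a finite vertex set with a symmetric
  irreflexive relation on it, the edge $\{u,v\}$ being represented by the two arcs
  $(u,v)$ and $(v,u)$. The degree of a vertex is therefore its out-degree.
\<close>

definition min_degree :: "'a pair_pre_digraph \<Rightarrow> nat" where
  "min_degree G = Min (out_degree (with_proj G) ` pverts G)"

text \<open>
  Restricting to extensional functions makes each bijection $V(X) \to V(Y)$ a single
  HOL function, whatever its values outside $V(X)$.
\<close>

definition bijections :: "'a set \<Rightarrow> 'b set \<Rightarrow> ('a \<Rightarrow> 'b) set" where
  "bijections A B = {\<sigma> \<in> extensional A. bij_betw \<sigma> A B}"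

definition FS_adj ::
  "'a pair_pre_digraph \<Rightarrow> 'b pair_pre_digraph \<Rightarrow> ('a \<Rightarrow> 'b) \<Rightarrow> ('a \<Rightarrow> 'b) \<Rightarrow> bool" where
  "FS_adj X Y \<sigma> \<tau> \<longleftrightarrow>
     (\<exists>a \<in> pverts X. \<exists>b \<in> pverts X. a \<noteq> b \<and> (a, b) \<in> parcs X \<and> (\<sigma> a, \<sigma> b) \<in> parcs Y \<and>
        \<tau> a = \<sigma> b \<and> \<tau> b = \<sigma> a \<and> (\<forall>w \<in> pverts X - {a, b}. \<tau> w = \<sigma> w))"

definition FS ::
  "'a pair_pre_digraph \<Rightarrow> 'b pair_pre_digraph \<Rightarrow> ('a \<Rightarrow> 'b) pair_pre_digraph" where
  "FS X Y =
     \<lparr> pverts = bijections (pverts X) (pverts Y),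
       parcs = {(\<sigma>, \<tau>). \<sigma> \<in> bijections (pverts X) (pverts Y) \<and>
                         \<tau> \<in> bijections (pverts X) (pverts Y) \<and> FS_adj X Y \<sigma> \<tau>} \<rparr>"

lemma finite_bijections:
  assumes "finite A" "finite B"
  shows "finite (bijections A B)"
proof (rule finite_subset)
  show "bijections A B \<subseteq> PiE A (\<lambda>_. B)"
    by (auto simp: bijections_def PiE_def dest: bij_betw_apply)
  show "finite (PiE A (\<lambda>_. B))"
    using assms by (intro finite_PiE) auto
qed

lemma FS_adj_sym:
  assumes X: "pair_graph X" and Y: "pair_graph Y" and "FS_adj X Y \<sigma> \<tau>"
  shows "FS_adj X Y \<tau> \<sigma>"
proof -
  obtain a b where ab: "a \<in> pverts X" "b \<in> pverts X" "a \<noteq> b" "(a, b) \<in> parcs X"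
    "(\<sigma> a, \<sigma> b) \<in> parcs Y" "\<tau> a = \<sigma> b" "\<tau> b = \<sigma> a" "\<forall>w \<in> pverts X - {a, b}. \<tau> w = \<sigma> w"
    using assms(3) unfolding FS_adj_def by blast
  have "sym (parcs Y)"
    using pair_sym_digraph.pair_sym_arcs[of Y] Y
    by (simp add: pair_graph_def pair_pseudo_graph_def symmetric_def)
  then have "(\<tau> a, \<tau> b) \<in> parcs Y"
    using ab by (auto dest: symD)
  then show ?thesis
    unfolding FS_adj_def using ab by (intro bexI[of _ a] bexI[of _ b]) auto
qed

lemma pair_graph_FS:
  assumes X: "pair_graph X" and Y: "pair_graph Y"
  shows "pair_graph (FS X Y)"
proof -
  interpret X: pair_graph X by fact
  interpret Y: pair_graph Y by fact
  have fin: "finite (bijections (pverts X) (pverts Y))"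
    by (rule finite_bijections) (rule X.pair_finite_verts Y.pair_finite_verts)+
  have sub: "parcs (FS X Y) \<subseteq> pverts (FS X Y) \<times> pverts (FS X Y)"
    by (auto simp: FS_def)
  show ?thesis
  proof unfold_locales
    show "finite (pverts (FS X Y))" using fin by (simp add: FS_def)
    then show "finite (parcs (FS X Y))" using sub by (meson finite_SigmaI finite_subset)
    show "symmetric (with_proj (FS X Y))"
      using FS_adj_sym[OF X Y] by (auto simp: symmetric_def sym_def FS_def)
    fix e assume e: "e \<in> parcs (FS X Y)"
    then show "fst e \<in> pverts (FS X Y)" "snd e \<in> pverts (FS X Y)" using sub by auto
    from e obtain a b where *: "a \<in> pverts X" "b \<in> pverts X" "a \<noteq> b" "snd e a = fst e b"
        "bij_betw (fst e) (pverts X) (pverts Y)"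
      by (auto simp: FS_def FS_adj_def bijections_def)
    then show "fst e \<noteq> snd e"
      by (metis bij_betw_imp_inj_on inj_onD)
  qed
qed

end

theory Submission
  imports Defs "HOL-Combinatorics.Transposition"
begin

text \<open>
  Let $X$ be the graph of larger minimum degree $d$ and $Y$ the other one, of minimum degree $e$.
  It suffices that for every bijection $\sigma$ and every edge $ab$ of $X$ the bijection
  $\sigma \circ (a\,b)$ is reachable from $\sigma$: since $d > n/2$, every transposition is a
  product of three transpositions along edges of $X$. Name each person after the position it occupies
  under $\sigma$, so that $Y$ becomes a graph $G$ on $V(X)$. Suppose that $(a\,b)$ is not reachable.
  Then $ab$ is not an edge of $G$, and by $e > n/2$ there is a common $G$-neighbour $q$ of $a$ and $b$. As
  $3d + 2e \ge 3n$, at least three further vertices lie in four of the five sets $N_X(a)$, $N_X(b)$,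
  $N_X(q)$, $N_G(a)$, $N_G(b)$. An explicit sequence of swaps performs $(a\,b)$ if two
  of them are $X$-adjacent to $a$, $b$, $q$ and $G$-adjacent to the same one of $a$, $b$; so one of them, $r$,
  is $G$-adjacent to both $a$ and $b$, and $b, a, r, q$ is a path in $X$ (up to exchanging $a$ and $b$).
  In that situation two more counts of the same kind produce a common $G$-neighbour $f$ of
  $a$ and $b$ that is $X$-adjacent to $b, r$ or to $a, q$, and a vertex $t$ with at least five of the
  eight possible adjacencies to $a, b, r, q$. With $f$ and $t$ at hand
  $(a\,b)$ is again performed by an explicit sequence of swaps.
\<close>

section \<open>Reachability by explicit swap sequences\<close>

text \<open>Reading \<open>\<pi> s\<close> as the person standing at position \<open>s\<close>,
  these are the arrangements reachable from the one in which everybody stands at the position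
  bearing their name.\<close>

inductive reach :: "('a \<Rightarrow> 'a \<Rightarrow> bool) \<Rightarrow> ('a \<Rightarrow> 'a \<Rightarrow> bool) \<Rightarrow> ('a \<Rightarrow> 'a) \<Rightarrow> bool"
  for X G where
    reach_id: "reach X G id"
  | reach_swap: "reach X G \<pi> \<Longrightarrow> X s t \<Longrightarrow> G (\<pi> s) (\<pi> t) \<Longrightarrow> reach X G (\<pi> \<circ> transpose s t)"

text \<open>
  Only the positions in the list \<open>vs\<close> are involved, and person \<open>ps ! i\<close> sits at position \<open>vs ! i\<close>.
  A pair of indices swaps the persons at these two positions. The concrete
  sequences below were found by breadth-first search.
\<close>
primrec swaps_to ::
  "('a \<Rightarrow> 'a \<Rightarrow> bool) \<Rightarrow> ('a \<Rightarrow> 'a \<Rightarrow> bool) \<Rightarrow> 'a list \<Rightarrow> 'a list \<Rightarrow> (nat \<times> nat) list \<Rightarrow> 'a list \<Rightarrow> bool"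
  where
    "swaps_to X G vs ps [] qs \<longleftrightarrow> ps = qs"
  | "swaps_to X G vs ps (ij # sw) qs \<longleftrightarrow>
       fst ij < length vs \<and> snd ij < length vs \<and> fst ij \<noteq> snd ij \<and>
       X (vs ! fst ij) (vs ! snd ij) \<and> G (ps ! fst ij) (ps ! snd ij) \<and>
       swaps_to X G vs (ps[fst ij := ps ! snd ij, snd ij := ps ! fst ij]) sw qs"

text \<open>Induction on the swaps, keeping the list \<open>ps\<close> and the permutation
  \<open>\<pi>\<close> in step; distinctness of \<open>vs\<close> makes list updates agree with
  composition by a transposition.\<close>

lemma reach_if_swaps_to_aux:
  assumes "swaps_to X G vs ps sw qs" "distinct vs" "length ps = length vs" "reach X G \<pi>"
    and "\<forall>i<length vs. \<pi> (vs ! i) = ps ! i" "\<forall>x. x \<notin> set vs \<longrightarrow> \<pi> x = x"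
  shows "\<exists>\<rho>. reach X G \<rho> \<and> (\<forall>i<length vs. \<rho> (vs ! i) = qs ! i) \<and> (\<forall>x. x \<notin> set vs \<longrightarrow> \<rho> x = x)"
  using assms
proof (induction sw arbitrary: ps \<pi>)
  case Nil
  then show ?case by auto
next
  case (Cons ij sw)
  obtain i j where ij: "ij = (i, j)" by (cases ij)
  have lt: "i < length vs" "j < length vs" "i \<noteq> j"
    and sw: "X (vs ! i) (vs ! j)" "G (ps ! i) (ps ! j)"
    "swaps_to X G vs (ps[i := ps ! j, j := ps ! i]) sw qs"
    using Cons.prems(1) by (simp_all add: ij)
  let ?\<pi> = "\<pi> \<circ> transpose (vs ! i) (vs ! j)"
  have r: "reach X G ?\<pi>"
    using Cons.prems(4,5) lt sw by (intro reach_swap) auto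
  have "\<forall>m<length vs. ?\<pi> (vs ! m) = ps[i := ps ! j, j := ps ! i] ! m"
    using Cons.prems(2,3,5) lt by (auto simp: transpose_def nth_list_update nth_eq_iff_index_eq)
  moreover have "\<forall>x. x \<notin> set vs \<longrightarrow> ?\<pi> x = x"
    using Cons.prems(6) lt by (auto simp: transpose_def)
  ultimately show ?case
    using Cons.IH[OF sw(3) Cons.prems(2) _ r] Cons.prems(3) by simp
qed

lemma reach_if_swaps_to:
  assumes "swaps_to X G (a # b # vs) (a # b # vs) sw (b # a # vs)" "distinct (a # b # vs)"
  shows "reach X G (transpose a b)"
proof -
  let ?vs = "a # b # vs"
  obtain \<rho> where \<rho>: "reach X G \<rho>" "\<forall>i<length ?vs. \<rho> (?vs ! i) = (b # a # vs) ! i"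
    "\<forall>x. x \<notin> set ?vs \<longrightarrow> \<rho> x = x"
    using reach_if_swaps_to_aux[OF assms(1,2) refl reach_id] by auto
  have "\<rho> x = transpose a b x" for x
  proof (cases "x \<in> set ?vs")
    case True
    then obtain i where "i < length ?vs" "x = ?vs ! i"
      by (metis in_set_conv_nth)
    then have x: "\<rho> x = (b # a # vs) ! i" "x = ?vs ! i" "i < length ?vs"
      using \<rho>(2) by auto
    show ?thesis
    proof (cases i)
      case 0
      then show ?thesis using x by simp
    next
      case (Suc m)
      then show ?thesis using x assms(2)
        by (cases m) (auto simp: transpose_def)
    qed
  next
    case False
    then show ?thesis using \<rho>(3) by (simp add: transpose_def)
  qed
  then have "\<rho> = transpose a b" by auto
  then show ?thesis using \<rho>(1) by simp
qed

section \<open>The local exchange argument\<close>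

lemma card_le_1I:
  assumes "finite A" "\<And>s t. s \<in> A \<Longrightarrow> t \<in> A \<Longrightarrow> s = t"
  shows "card A \<le> 1"
  using assms by (metis One_nat_def card_le_Suc0_iff_eq)

text \<open>In the applications \<open>h t\<close> is a weighted number of adjacencies of
  \<open>t\<close> to the vertices of \<open>W\<close>, and minimum degrees bound its sum from
  below. The upper bound uses \<open>h t \<le> m + of_bool (t \<in> S)\<close> outside
  \<open>W\<close>.\<close>

lemma sum_le_with_exceptions:
  fixes h :: "'a \<Rightarrow> nat"
  assumes "finite V" "W \<subseteq> V" "S \<subseteq> V - W"
    and "\<And>t. t \<in> V - W \<Longrightarrow> t \<notin> S \<Longrightarrow> h t \<le> m" "\<And>t. t \<in> S \<Longrightarrow> h t \<le> Suc m"
  shows "sum h V \<le> sum h W + m * (card V - card W) + card S"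
proof -
  have fin: "finite W" "finite S" using assms(1-3) by (auto intro: finite_subset)
  have "sum h (V - W) \<le> (\<Sum>t\<in>V - W. m + of_bool (t \<in> S))"
    using assms(4,5) by (intro sum_mono) (force simp: of_bool_def)
  also have "\<dots> = m * card (V - W) + card S"
    using assms(1,3) by (simp add: sum.distrib Int_absorb1)
  also have "card (V - W) = card V - card W"
    using assms(2) fin by (simp add: card_Diff_subset)
  finally have "sum h (V - W) \<le> m * (card V - card W) + card S" .
  moreover have "sum h V = sum h W + sum h (V - W)"
    using assms(1,2) by (metis add.commute sum.subset_diff)
  ultimately show ?thesis by simp
qed

text \<open>Both graphs live on the positions: \<open>G\<close> stands for the friendship graph
  pulled back along the current bijection. In \<open>de_ge\<close>, \<open>d\<close> takes the place
  of the larger minimum degree.\<close>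

locale dense_graphs =
  fixes V :: "'a set" and X G :: "'a \<Rightarrow> 'a \<Rightarrow> bool" and d e :: nat
  assumes finV: "finite V"
    and X_sym: "X s t \<longleftrightarrow> X t s" and G_sym: "G s t \<longleftrightarrow> G t s"
    and X_irrefl [simp]: "\<not> X s s" and G_irrefl [simp]: "\<not> G s s"
    and X_in: "X s t \<Longrightarrow> s \<in> V" and G_in: "G s t \<Longrightarrow> s \<in> V"
    and X_deg: "s \<in> V \<Longrightarrow> d \<le> card {t \<in> V. X s t}"
    and G_deg: "s \<in> V \<Longrightarrow> e \<le> card {t \<in> V. G s t}"
    and d_gt: "card V < 2 * d" and e_gt: "card V < 2 * e"
    and de_ge: "3 * card V \<le> 3 * d + 2 * e" and V_ge: "6 \<le> card V"
begin

text \<open>As sums of indicators, the degrees of several vertices add up to a single sum of weights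
  over \<open>V\<close>.\<close>

lemma X_sum: "s \<in> V \<Longrightarrow> d \<le> (\<Sum>t\<in>V. of_bool (X s t))"
  using X_deg finV by (simp add: Int_def)

lemma G_sum: "s \<in> V \<Longrightarrow> e \<le> (\<Sum>t\<in>V. of_bool (G s t))"
  using G_deg finV by (simp add: Int_def)

section \<open>Configurations excluded when the transposition is unreachable\<close>

context
  fixes a b
  assumes not_reach: "\<not> reach X G (transpose a b)"
begin

text \<open>Turns a swap sequence for \<open>(a b)\<close> into a forbidden configuration:
  \<open>P\<close> supplies the adjacencies that make the sequence legal.\<close>

lemma not_swaps:
  assumes "P \<Longrightarrow> swaps_to X G (a # b # vs) (a # b # vs) sw (b # a # vs)"
    and "P \<Longrightarrow> distinct (a # b # vs)"
  shows "\<not> P"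
  using reach_if_swaps_to assms not_reach by metis

lemma not_reach_imp_no_edge:
  assumes "X a b"
  shows "\<not> G a b"
  using reach_swap[OF reach_id, of X a b G] assms not_reach by auto

text \<open>The common friend \<open>t\<close> mediates: \<open>a\<close> and \<open>b\<close> swap
  only with \<open>t\<close>, never with each other.\<close>

lemma no_triangle:
  assumes "X a b"
  shows "\<not> (X a t \<and> X b t \<and> G a t \<and> G b t)"
  using assms
  by (intro not_swaps[of _ "[t]" "[(0,2), (0,1), (1,2)]"]) (auto simp: X_sym G_sym)

section \<open>An \<open>X\<close>-path \<open>b\<close>, \<open>a\<close>, \<open>r\<close>,
  \<open>q\<close> whose vertices \<open>r\<close>, \<open>q\<close> are common friends of
  \<open>a\<close> and \<open>b\<close>\<close>

context
  fixes r q
  assumes path: "X a b" "X a r" "X r q" and persons: "G a r" "G a q" "G b r" "G b q"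
begin

lemma base_distinct: "distinct [a, b, r, q]"
  using path persons by auto

text \<open>
  Each of the configurations excluded in the next two proofs admits a sequence of swaps
  performing \<open>(a b)\<close>, and every choice of five adjacencies of \<open>t\<close> contains one of them.
\<close>
lemma few_adjacent_br:
  assumes "X b f" "X r f" "G a f" "G b f"
    and "distinct [a, b, r, q, f, t]"
  shows "(of_bool (X a t) + of_bool (X b t) + of_bool (X r t) + of_bool (X q t) +
    of_bool (G a t) + of_bool (G b t) + of_bool (G r t) + of_bool (G q t)) \<le> (4 :: nat)"
proof -
  note base = path persons assms
  have "\<not> (X r t \<and> G b t \<and> G r t)"
    by (rule not_swaps[of _ "[r, q, f, t]"
        "[(1,4), (2,4), (2,5), (2,4), (0,2), (2,3), (2,5), (0,2), (2,4), (0,2),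
        (2,5), (2,3), (2,4), (0,2), (1,4), (2,5), (0,2)]"])
      (use base in \<open>simp_all add: X_sym G_sym\<close>)
  moreover have "\<not> (X a t \<and> X b t \<and> G a t)"
    by (rule not_swaps[of _ "[r, q, f, t]"
        "[(1,4), (2,4), (2,3), (0,5), (1,5), (1,4), (2,4), (0,2), (0,1), (1,5),
        (0,5), (0,2), (2,4), (2,3), (1,4), (0,1), (0,5), (0,2), (1,5)]"])
      (use base in \<open>simp_all add: X_sym G_sym\<close>)
  moreover have "\<not> (X r t \<and> G a t \<and> G q t)"
    by (rule not_swaps[of _ "[r, q, f, t]"
        "[(0,2), (0,1), (2,5), (2,3), (0,2), (2,4), (2,5), (0,2), (2,3), (0,2),
        (2,5), (2,4), (2,3), (0,2), (2,5), (0,2), (0,1), (2,3), (0,2)]"])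
      (use base in \<open>simp_all add: X_sym G_sym\<close>)
  moreover have "\<not> (X a t \<and> X b t \<and> G b t)"
    by (rule not_swaps[of _ "[r, q, f, t]"
        "[(0,2), (0,1), (2,3), (0,5), (1,5), (1,4), (2,4), (0,2), (0,1), (1,5),
        (0,5), (0,2), (2,4), (2,3), (1,4), (2,4), (1,5), (1,4), (0,5)]"])
      (use base in \<open>simp_all add: X_sym G_sym\<close>)
  moreover have "\<not> (X b t \<and> X q t \<and> G r t \<and> G q t)"
    by (rule not_swaps[of _ "[r, q, f, t]"
        "[(1,4), (2,4), (2,3), (0,2), (2,4), (1,4), (0,1), (0,2), (1,5), (0,1),
        (3,5), (2,3), (0,2), (1,5), (0,1), (3,5), (2,3), (1,5), (3,5)]"])
      (use base in \<open>simp_all add: X_sym G_sym\<close>)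
  moreover have "\<not> (X a t \<and> X q t \<and> G b t \<and> G q t)"
    by (rule not_swaps[of _ "[r, q, f, t]"
        "[(0,2), (0,1), (0,5), (3,5), (0,5), (0,2), (0,1), (2,3), (0,2)]"])
      (use base in \<open>simp_all add: X_sym G_sym\<close>)
  moreover have "\<not> (X a t \<and> X q t \<and> G a t \<and> G r t)"
    by (rule not_swaps[of _ "[r, q, f, t]"
        "[(0,2), (2,3), (1,4), (2,4), (0,5), (3,5), (2,3), (0,5), (0,2), (2,4),
        (2,3), (0,2), (1,4)]"])
      (use base in \<open>simp_all add: X_sym G_sym\<close>)
  moreover have "\<not> (X b t \<and> X q t \<and> G a t \<and> G b t)"
    by (rule not_swaps[of _ "[r, q, f, t]"
        "[(0,2), (0,1), (2,3), (0,2), (3,5), (2,3), (1,5), (0,1), (0,2), (3,5),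
        (2,3), (1,5), (0,1), (3,5), (1,5)]"])
      (use base in \<open>simp_all add: X_sym G_sym\<close>)
  moreover have "\<not> (X a t \<and> X b t \<and> X r t \<and> G r t)"
    by (rule not_swaps[of _ "[r, q, f, t]" "[(2,5), (0,5), (0,1), (1,5), (2,5)]"])
      (use base in \<open>simp_all add: X_sym G_sym\<close>)
  moreover have "\<not> (X a t \<and> X r t \<and> X q t \<and> G q t)"
    by (rule not_swaps[of _ "[r, q, f, t]"
        "[(0,2), (0,1), (3,5), (0,5), (0,2), (0,1), (2,5), (0,2), (3,5)]"])
      (use base in \<open>simp_all add: X_sym G_sym\<close>)
  moreover have "\<not> (X a t \<and> G a t \<and> G b t \<and> G r t)"
    by (rule not_swaps[of _ "[r, q, f, t]" "[(0,2), (0,1), (0,5), (0,1), (0,2), (0,1), (0,5)]"])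
      (use base in \<open>simp_all add: X_sym G_sym\<close>)
  moreover have "\<not> (X q t \<and> G a t \<and> G b t \<and> G r t \<and> G q t)"
    by (rule not_swaps[of _ "[r, q, f, t]"
        "[(0,2), (1,4), (3,5), (2,3), (0,2), (2,4), (0,2), (2,3), (2,4), (1,4),
        (3,5)]"])
      (use base in \<open>simp_all add: X_sym G_sym\<close>)
  moreover have "\<not> (X r t \<and> X q t \<and> G a t \<and> G b t)"
    by (rule not_swaps[of _ "[r, q, f, t]"
        "[(0,2), (0,1), (2,3), (0,2), (2,5), (2,3), (0,2), (0,1), (3,5), (2,3),
        (0,2)]"])
      (use base in \<open>simp_all add: X_sym G_sym\<close>)
  moreover have "\<not> (X b t \<and> G a t \<and> G b t \<and> G r t)"
    by (rule not_swaps[of _ "[r, q, f, t]"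
        "[(0,2), (0,1), (2,4), (1,4), (1,5), (0,1), (1,4), (0,1), (2,4), (0,2),
        (1,5)]"])
      (use base in \<open>simp_all add: X_sym G_sym\<close>)
  moreover have "\<not> (X b t \<and> X r t \<and> X q t \<and> G r t)"
    by (rule not_swaps[of _ "[r, q, f, t]"
        "[(0,2), (0,1), (2,3), (0,2), (1,5), (2,5), (2,3), (0,2), (3,5), (2,3),
        (1,5), (0,1), (0,2)]"])
      (use base in \<open>simp_all add: X_sym G_sym\<close>)
  moreover have "\<not> (X b t \<and> X r t \<and> X q t \<and> G b t)"
    by (rule not_swaps[of _ "[r, q, f, t]"
        "[(0,2), (2,3), (1,5), (2,5), (0,2), (2,3), (2,4), (0,2), (2,3), (3,5),
        (1,5), (0,1), (1,4)]"])
      (use base in \<open>simp_all add: X_sym G_sym\<close>)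
  ultimately show ?thesis
    by (auto simp: of_bool_def)
qed

lemma few_adjacent_aq:
  assumes "X a f" "X q f" "G a f" "G b f"
    and "distinct [a, b, r, q, f, t]"
  shows "(of_bool (X a t) + of_bool (X b t) + of_bool (X r t) + of_bool (X q t) +
    of_bool (G a t) + of_bool (G b t) + of_bool (G r t) + of_bool (G q t)) \<le> (4 :: nat)"
proof -
  note base = path persons assms
  have "\<not> (X a t \<and> G b t \<and> G r t)"
    by (rule not_swaps[of _ "[r, q, f, t]"
        "[(0,2), (0,1), (0,5), (0,1), (0,2), (0,4), (0,5), (0,1), (0,2), (0,1),
        (0,5), (0,4), (0,1), (0,2), (0,5)]"])
      (use base in \<open>simp_all add: X_sym G_sym\<close>)
  moreover have "\<not> (X r t \<and> X q t \<and> G a t)"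
    by (rule not_swaps[of _ "[r, q, f, t]"
        "[(0,2), (2,5), (3,5), (3,4), (0,4), (0,2), (2,3), (3,5), (2,5), (0,2),
        (0,4), (0,1), (3,4), (2,3), (2,5), (0,2), (3,5), (3,4), (0,4), (0,1), (0,2)]"])
      (use base in \<open>simp_all add: X_sym G_sym\<close>)
  moreover have "\<not> (X a t \<and> G a t \<and> G q t)"
    by (rule not_swaps[of _ "[r, q, f, t]"
        "[(0,2), (0,1), (2,3), (0,2), (3,4), (0,4), (0,5), (0,4), (0,2), (0,1),
        (0,5), (0,2), (0,4), (0,2), (0,5), (0,1), (0,4), (0,2), (3,4), (2,3),
        (0,5), (0,1), (0,2)]"])
      (use base in \<open>simp_all add: X_sym G_sym\<close>)
  moreover have "\<not> (X r t \<and> X q t \<and> G b t)"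
    by (rule not_swaps[of _ "[r, q, f, t]"
        "[(0,2), (0,1), (2,3), (0,2), (3,4), (0,4), (0,1), (2,5), (3,5), (3,4),
        (0,4), (0,2), (2,3), (3,5), (2,5), (0,2), (0,4), (3,4), (3,5), (2,5), (0,2)]"])
      (use base in \<open>simp_all add: X_sym G_sym\<close>)
  moreover have "\<not> (X b t \<and> X q t \<and> G r t \<and> G q t)"
    by (rule not_swaps[of _ "[r, q, f, t]"
        "[(0,2), (0,1), (0,4), (3,4), (1,5), (3,5), (2,3), (3,4), (0,4), (0,2),
        (0,1), (2,3), (0,2), (1,5), (0,1), (3,5), (2,3), (1,5), (3,5)]"])
      (use base in \<open>simp_all add: X_sym G_sym\<close>)
  moreover have "\<not> (X b t \<and> X r t \<and> G a t \<and> G r t)"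
    by (rule not_swaps[of _ "[r, q, f, t]" "[(0,2), (0,1), (1,5), (2,5), (1,5)]"])
      (use base in \<open>simp_all add: X_sym G_sym\<close>)
  moreover have "\<not> (X b t \<and> X r t \<and> G b t \<and> G q t)"
    by (rule not_swaps[of _ "[r, q, f, t]"
        "[(0,2), (2,3), (3,4), (0,4), (1,5), (2,5), (1,5), (0,1), (0,2), (0,4),
        (3,4), (2,3), (0,2)]"])
      (use base in \<open>simp_all add: X_sym G_sym\<close>)
  moreover have "\<not> (X b t \<and> X q t \<and> G a t \<and> G b t)"
    by (rule not_swaps[of _ "[r, q, f, t]"
        "[(0,2), (0,1), (2,3), (0,2), (3,5), (2,3), (1,5), (0,1), (0,2), (3,5),
        (2,3), (1,5), (0,1), (3,5), (1,5)]"])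
      (use base in \<open>simp_all add: X_sym G_sym\<close>)
  moreover have "\<not> (X a t \<and> X b t \<and> X q t \<and> G q t)"
    by (rule not_swaps[of _ "[r, q, f, t]" "[(3,5), (0,5), (0,1), (1,5), (3,5)]"])
      (use base in \<open>simp_all add: X_sym G_sym\<close>)
  moreover have "\<not> (X a t \<and> X b t \<and> X r t \<and> G r t)"
    by (rule not_swaps[of _ "[r, q, f, t]" "[(2,5), (0,5), (0,1), (1,5), (2,5)]"])
      (use base in \<open>simp_all add: X_sym G_sym\<close>)
  moreover have "\<not> (X a t \<and> X b t \<and> G a t \<and> G b t)"
    by (rule not_swaps[of _ "[r, q, f, t]" "[(0,5), (0,1), (1,5)]"])
      (use base in \<open>simp_all add: X_sym G_sym\<close>)
  moreover have "\<not> (X a t \<and> X r t \<and> X q t \<and> G q t)"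
    by (rule not_swaps[of _ "[r, q, f, t]"
        "[(0,2), (0,1), (3,5), (0,5), (0,2), (0,1), (2,5), (0,2), (3,5)]"])
      (use base in \<open>simp_all add: X_sym G_sym\<close>)
  moreover have "\<not> (X q t \<and> G b t \<and> G r t \<and> G q t)"
    by (rule not_swaps[of _ "[r, q, f, t]"
        "[(0,4), (0,1), (0,2), (0,4), (0,1), (3,5), (2,3), (3,4), (2,3), (0,4),
        (3,5)]"])
      (use base in \<open>simp_all add: X_sym G_sym\<close>)
  moreover have "\<not> (X r t \<and> G b t \<and> G r t \<and> G q t)"
    by (rule not_swaps[of _ "[r, q, f, t]"
        "[(0,4), (0,1), (2,5), (0,2), (2,3), (0,2), (0,4), (0,1), (3,4), (0,4),
        (2,5)]"])
      (use base in \<open>simp_all add: X_sym G_sym\<close>)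
  moreover have "\<not> (X a t \<and> X b t \<and> X q t \<and> G r t)"
    by (rule not_swaps[of _ "[r, q, f, t]"
        "[(0,4), (3,4), (2,3), (0,2), (3,5), (0,5), (0,1), (0,2), (1,5), (3,5),
        (2,3), (3,4), (0,4)]"])
      (use base in \<open>simp_all add: X_sym G_sym\<close>)
  moreover have "\<not> (X b t \<and> G a t \<and> G b t \<and> G r t \<and> G q t)"
    by (rule not_swaps[of _ "[r, q, f, t]"
        "[(0,2), (0,1), (2,3), (0,2), (3,4), (0,4), (0,1), (1,5), (0,1), (0,2),
        (0,4), (0,2), (0,1), (3,4), (2,3), (0,2), (1,5)]"])
      (use base in \<open>simp_all add: X_sym G_sym\<close>)
  ultimately show ?thesis
    by (auto simp: of_bool_def)
qed

text \<open>With its counterpart for \<open>b\<close>, this keeps the exceptional vertices in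
  \<open>common_friend_exists\<close> at weight 7: weight 8 would need \<open>X\<close>-adjacency to
  all four path vertices.\<close>

lemma no_dense_vertex_a:
  assumes "distinct [a, b, r, q, t]"
  shows "\<not> (X a t \<and> X b t \<and> X r t \<and> X q t \<and> G a t)"
  by (rule not_swaps[of _ "[r, q, t]"
      "[(0,4), (2,4), (2,3), (1,4), (2,4), (3,4), (0,4), (0,1), (0,2)]"])
    (use path persons assms in \<open>simp_all add: X_sym G_sym\<close>)

lemma no_dense_vertex_b:
  assumes "distinct [a, b, r, q, t]"
  shows "\<not> (X a t \<and> X b t \<and> X r t \<and> X q t \<and> G b t)"
  by (rule not_swaps[of _ "[r, q, t]"
      "[(0,2), (0,1), (2,3), (0,4), (2,4), (3,4), (1,4), (2,4), (0,4)]"])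
    (use path persons assms in \<open>simp_all add: X_sym G_sym\<close>)

text \<open>A common friend of \<open>a\<close> and \<open>b\<close> cannot be
  \<open>X\<close>-adjacent to both \<open>a\<close> and \<open>b\<close> by
  \<open>no_triangle\<close>, nor to \<open>a\<close>, \<open>r\<close> or to \<open>b\<close>,
  \<open>q\<close> by this lemma and the next. Of the pairs involving \<open>a\<close> or
  \<open>b\<close>, only \<open>b\<close>, \<open>r\<close> and \<open>a\<close>, \<open>q\<close>
  remain.\<close>

lemma no_common_friend_ar:
  assumes "distinct [a, b, r, q, t]"
  shows "\<not> (X a t \<and> X r t \<and> G a t \<and> G b t)"
  by (rule not_swaps[of _ "[r, q, t]" "[(0,2), (0,1), (0,4), (0,2), (0,1), (2,4), (0,2)]"])
    (use path persons assms in \<open>simp_all add: X_sym G_sym\<close>)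

lemma no_common_friend_bq:
  assumes "distinct [a, b, r, q, t]"
  shows "\<not> (X b t \<and> X q t \<and> G a t \<and> G b t)"
  by (rule not_swaps[of _ "[r, q, t]"
      "[(0,2), (0,1), (2,3), (0,2), (3,4), (2,3), (1,4), (0,1), (0,2), (3,4), (2,3),
      (1,4), (0,1), (3,4), (1,4)]"])
    (use path persons assms in \<open>simp_all add: X_sym G_sym\<close>)

text \<open>Two such vertices together would allow a swap sequence for \<open>(a b)\<close>,
  whichever of \<open>r\<close> and \<open>q\<close> each is attached to; the mixed case is applied
  in both orders.\<close>

lemma card_excess_a:
  "card {t \<in> V - {a, b, r, q}. X a t \<and> X b t \<and> (X r t \<or> X q t) \<and> G a t} \<le> 1" (is "card ?U \<le> 1")
proof -
  have rr: "\<not> (X a t \<and> X b t \<and> X r t \<and> G a t \<and> X a t' \<and> X b t' \<and> X r t' \<and> G a t')"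
    if "distinct [a, b, r, q, t, t']" for t t'
    by (rule not_swaps[of _ "[r, q, t, t']"
        "[(0,4), (2,4), (1,4), (2,5), (0,5), (0,1), (0,4), (1,5), (2,5), (2,4),
        (1,4)]"])
      (use path persons that in \<open>simp_all add: X_sym G_sym\<close>)
  have rq: "\<not> (X a t \<and> X b t \<and> X r t \<and> G a t \<and> X a t' \<and> X b t' \<and> X q t' \<and> G a t')"
    if "distinct [a, b, r, q, t, t']" for t t'
    by (rule not_swaps[of _ "[r, q, t, t']"
        "[(0,4), (2,4), (2,3), (1,4), (3,5), (0,5), (0,1), (0,4), (1,5), (3,5),
        (2,3), (2,4), (1,4)]"])
      (use path persons that in \<open>simp_all add: X_sym G_sym\<close>)
  have qq: "\<not> (X a t \<and> X b t \<and> X q t \<and> G a t \<and> X a t' \<and> X b t' \<and> X q t' \<and> G a t')"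
    if "distinct [a, b, r, q, t, t']" for t t'
    by (rule not_swaps[of _ "[r, q, t, t']"
        "[(0,4), (3,4), (1,4), (3,5), (0,5), (0,1), (0,4), (1,5), (3,5), (3,4),
        (1,4)]"])
      (use path persons that in \<open>simp_all add: X_sym G_sym\<close>)
  have eq: "t = t'" if "t \<in> ?U" "t' \<in> ?U" for t t'
    using that rr[of t t'] rq[of t t'] rq[of t' t] qq[of t t'] base_distinct by auto
  show ?thesis by (rule card_le_1I[OF _ eq]) (simp add: finV)
qed

lemma card_excess_b:
  "card {t \<in> V - {a, b, r, q}. X a t \<and> X b t \<and> (X r t \<or> X q t) \<and> G b t} \<le> 1" (is "card ?U \<le> 1")
proof -
  have rr: "\<not> (X a t \<and> X b t \<and> X r t \<and> G b t \<and> X a t' \<and> X b t' \<and> X r t' \<and> G b t')"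
    if "distinct [a, b, r, q, t, t']" for t t'
    by (rule not_swaps[of _ "[r, q, t, t']"
        "[(1,4), (2,4), (0,4), (2,5), (0,5), (0,1), (1,5), (1,4), (2,5), (2,4),
        (0,4)]"])
      (use path persons that in \<open>simp_all add: X_sym G_sym\<close>)
  have rq: "\<not> (X a t \<and> X b t \<and> X r t \<and> G b t \<and> X a t' \<and> X b t' \<and> X q t' \<and> G b t')"
    if "distinct [a, b, r, q, t, t']" for t t'
    by (rule not_swaps[of _ "[r, q, t, t']"
        "[(1,4), (2,4), (2,3), (0,4), (3,5), (0,5), (0,1), (1,5), (1,4), (3,5),
        (2,3), (2,4), (0,4)]"])
      (use path persons that in \<open>simp_all add: X_sym G_sym\<close>)
  have qq: "\<not> (X a t \<and> X b t \<and> X q t \<and> G b t \<and> X a t' \<and> X b t' \<and> X q t' \<and> G b t')"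
    if "distinct [a, b, r, q, t, t']" for t t'
    by (rule not_swaps[of _ "[r, q, t, t']"
        "[(1,4), (3,4), (0,4), (3,5), (0,5), (0,1), (1,5), (1,4), (3,5), (3,4),
        (0,4)]"])
      (use path persons that in \<open>simp_all add: X_sym G_sym\<close>)
  have eq: "t = t'" if "t \<in> ?U" "t' \<in> ?U" for t t'
    using that rr[of t t'] rq[of t t'] rq[of t' t] qq[of t t'] base_distinct by auto
  show ?thesis by (rule card_le_1I[OF _ eq]) (simp add: finV)
qed

lemma common_friend_exists:
  obtains f where "distinct [a, b, r, q, f]" "G a f" "G b f" "X b f \<and> X r f \<or> X a f \<and> X q f"
proof -
  let ?W = "{a, b, r, q}"
  \<comment> \<open>The weights make the lower bound \<open>6 * d + 4 * e\<close>, twice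
    \<open>3 * d + 2 * e\<close> and so at least \<open>6 * card V\<close>.\<close>
  let ?h = "\<lambda>t. 2 * of_bool (X a t) + 2 * of_bool (X b t) + of_bool (X r t) + of_bool (X q t) +
    2 * of_bool (G a t) + 2 * of_bool (G b t) :: nat"
  let ?U = "\<lambda>c. {t \<in> V - ?W. X a t \<and> X b t \<and> (X r t \<or> X q t) \<and> G c t}"
  have "\<exists>f. f \<notin> ?W \<and> G a f \<and> G b f \<and> (X b f \<and> X r f \<or> X a f \<and> X q f)"
  proof (rule ccontr)
    assume none: "\<not> ?thesis"
    have V: "?W \<subseteq> V" using path persons X_in G_in X_sym G_sym by blast
    have dist: "distinct [a, b, r, q, t]" if "t \<in> V - ?W" for t
      using that base_distinct by auto
    have nG: "\<not> G a b" using not_reach path not_reach_imp_no_edge by blast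
    have "6 * d + 4 * e \<le> sum ?h V"
      using X_sum[of a] X_sum[of b] X_sum[of r] X_sum[of q] G_sum[of a] G_sum[of b] V
      by (simp add: sum.distrib flip: sum_distrib_left)
    also have "\<dots> \<le> sum ?h ?W + 6 * (card V - card ?W) + card (?U a \<union> ?U b)"
    proof (rule sum_le_with_exceptions[OF finV V])
      show "?U a \<union> ?U b \<subseteq> V - ?W" by blast
      \<comment> \<open>A common friend of \<open>a\<close> and \<open>b\<close> gets 4 from
        \<open>G\<close> and, by the exclusions, at most 2 from \<open>X\<close>. A friend of just
        one of them exceeds 6 only inside \<open>?U a \<union> ?U b\<close>.\<close>
      show "?h t \<le> 6" if "t \<in> V - ?W" "t \<notin> ?U a \<union> ?U b" for t
        using that none no_triangle[OF path(1), of t] no_common_friend_ar[OF dist[OF that(1)]]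
          no_common_friend_bq[OF dist[OF that(1)]]
        by (auto simp: of_bool_def)
      show "?h t \<le> Suc 6" if "t \<in> ?U a \<union> ?U b" for t
        using that none no_triangle[OF path(1), of t] no_dense_vertex_a[of t] no_dense_vertex_b[of t] dist[of t]
        by (auto simp: of_bool_def)
    qed
    \<comment> \<open>By \<open>no_triangle\<close>, \<open>r\<close> is not
      \<open>X\<close>-adjacent to \<open>b\<close>, and \<open>q\<close> is
      \<open>X\<close>-adjacent to at most one of \<open>a\<close>, \<open>b\<close>. The certain
      adjacencies give 17, the possible one 3 more; the edge \<open>r q\<close> of \<open>G\<close>
      does not enter.\<close>
    also have "sum ?h ?W \<le> 20"
      using path persons base_distinct nG no_triangle[OF path(1), of r] no_triangle[OF path(1), of q]
      by (auto simp: of_bool_def X_sym G_sym)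
    also have "card (?U a \<union> ?U b) \<le> 2"
      using card_Un_le[of "?U a" "?U b"] card_excess_a card_excess_b by linarith
    also have "card ?W = 4" using base_distinct by simp
    \<comment> \<open>The upper bound is \<open>20 + 6 * (card V - 4) + 2 = 6 * card V - 2\<close>,
      below the lower bound.\<close>
    finally show False using de_ge V_ge by linarith
  qed
  then obtain f where f: "f \<notin> ?W" "G a f" "G b f" "X b f \<and> X r f \<or> X a f \<and> X q f" by blast
  moreover have "distinct [a, b, r, q, f]" using f(1) base_distinct by auto
  ultimately show ?thesis using that by blast
qed

text \<open>The degrees of all four path vertices in both graphs are counted at once; with
  \<open>f\<close> at hand, no further vertex has more than four of the eight adjacencies, which is
  too few.\<close>

lemma impossible: False
proof -
  obtain f where f: "distinct [a, b, r, q, f]" "G a f" "G b f" "X b f \<and> X r f \<or> X a f \<and> X q f"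
    by (rule common_friend_exists)
  let ?W = "{a, b, r, q, f}"
  let ?h = "\<lambda>t. of_bool (X a t) + of_bool (X b t) + of_bool (X r t) + of_bool (X q t) +
    of_bool (G a t) + of_bool (G b t) + of_bool (G r t) + of_bool (G q t) :: nat"
  have V: "?W \<subseteq> V" using path persons f X_in G_in X_sym G_sym by blast
  have nG: "\<not> G a b" using not_reach path not_reach_imp_no_edge by blast
  have "4 * d + 4 * e \<le> sum ?h V"
    using X_sum[of a] X_sum[of b] X_sum[of r] X_sum[of q]
      G_sum[of a] G_sum[of b] G_sum[of r] G_sum[of q] V
    by (simp add: sum.distrib)
  also have "\<dots> \<le> sum ?h ?W + 4 * (card V - card ?W) + card ({} :: 'a set)"
  proof (rule sum_le_with_exceptions[OF finV V])
    show "?h t \<le> 4" if "t \<in> V - ?W" for t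
    proof -
      have "distinct [a, b, r, q, f, t]" using that f(1) by auto
      then show ?thesis using f few_adjacent_br few_adjacent_aq by blast
    qed
  qed auto
  also have "sum ?h ?W \<le> 26"
  proof -
    \<comment> \<open>This is twice the number of edges inside the path: at most four in
      \<open>X\<close>, where \<open>b r\<close> and at least one of \<open>a q\<close>,
      \<open>b q\<close> are missing, and at most five in \<open>G\<close>, where \<open>a b\<close>
      is missing.\<close>
    have "?h a + ?h b + ?h r + ?h q \<le> 18"
      using path persons base_distinct nG no_triangle[OF path(1), of r] no_triangle[OF path(1), of q]
      by (auto simp: of_bool_def X_sym G_sym)
    moreover have "?h f \<le> 8" by (simp add: of_bool_def)
    moreover have "sum ?h ?W = ?h a + ?h b + ?h r + ?h q + ?h f"
      using f(1) by (simp del: of_bool_eq_1_iff)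
    ultimately show ?thesis by linarith
  qed
  also have "card ?W = 5" using f(1) by simp
  finally have "4 * d + 4 * e \<le> 26 + 4 * (card V - 5)" by simp
  \<comment> \<open>Integrality rounds \<open>card V + 3/2\<close> down. With \<open>de_ge\<close>
    this yields \<open>d \<ge> card V - 2\<close>, hence \<open>e \<le> 3\<close>, whereas
    \<open>e > card V / 2 \<ge> 3\<close>.\<close>
  then have "d + e \<le> card V + 1" using V_ge by linarith
  then show False using de_ge d_gt e_gt V_ge by linarith
qed

end

end

section \<open>Transpositions along edges of \<open>X\<close>\<close>

lemma reach_if_X_path:
  assumes "X a b" "X a r" "X r q" "G a r" "G a q" "G b r" "G b q"
  shows "reach X G (transpose a b)"
  using impossible assms by blast

lemma reach_if_X_edge:
  assumes ab: "X a b"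
  shows "reach X G (transpose a b)"
proof (rule ccontr)
  assume not_reach: "\<not> ?thesis"
  note not_swaps = not_swaps[OF not_reach] and no_triangle = no_triangle[OF not_reach ab]
  have not_reach': "\<not> reach X G (transpose b a)"
    using not_reach by (simp add: transpose_commute)
  have nG: "\<not> G a b" using not_reach_imp_no_edge[OF not_reach ab] .
  have abV: "a \<in> V" "b \<in> V" using ab X_in X_sym by blast+
  obtain q where q: "G a q" "G b q"
  proof -
    have "\<exists>q. G a q \<and> G b q"
    proof (rule ccontr)
      assume none: "\<nexists>q. G a q \<and> G b q"
      have "2 * e \<le> (\<Sum>t\<in>V. of_bool (G a t) + of_bool (G b t))"
        using G_sum[of a] G_sum[of b] abV by (simp add: sum.distrib)
      also have "\<dots> \<le> (\<Sum>t\<in>V. 1)"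
        using none by (intro sum_mono) (auto simp: of_bool_def)
      finally show False using e_gt by simp
    qed
    then show ?thesis using that by blast
  qed
  let ?W = "{a, b, q}"
  let ?h = "\<lambda>t. of_bool (X a t) + of_bool (X b t) + of_bool (X q t) +
    of_bool (G a t) + of_bool (G b t) :: nat"
  let ?U = "\<lambda>c. {t \<in> V - ?W. X a t \<and> X b t \<and> X q t \<and> G c t}"
  have dist: "distinct [a, b, q]" using ab q by auto
  have V: "?W \<subseteq> V" using abV q G_in G_sym by blast
  have "3 * d + 2 * e \<le> sum ?h V"
    using X_sum[of a] X_sum[of b] X_sum[of q] G_sum[of a] G_sum[of b] V
    by (simp add: sum.distrib)
  also have "\<dots> \<le> sum ?h ?W + 3 * (card V - card ?W) + card (?U a \<union> ?U b)"
  proof (rule sum_le_with_exceptions[OF finV V])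
    show "?U a \<union> ?U b \<subseteq> V - ?W" by blast
    \<comment> \<open>Such a \<open>t\<close> would serve as \<open>r\<close> in the path lemma,
      with the path \<open>b\<close>, \<open>a\<close>, \<open>t\<close>, \<open>q\<close> or
      \<open>a\<close>, \<open>b\<close>, \<open>t\<close>, \<open>q\<close>.\<close>
    have no: "\<not> (X a t \<and> X q t \<and> G a t \<and> G b t)" "\<not> (X b t \<and> X q t \<and> G a t \<and> G b t)" for t
      using reach_if_X_path[of a b t q] reach_if_X_path[of b a t q] ab q not_reach not_reach' X_sym by blast+
    show "?h t \<le> 3" if "t \<in> V - ?W" "t \<notin> ?U a \<union> ?U b" for t
      using that no[of t] no_triangle[of t] by (auto simp: of_bool_def)
    show "?h t \<le> Suc 3" if "t \<in> ?U a \<union> ?U b" for t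
      using that no[of t] no_triangle[of t] by (auto simp: of_bool_def)
  qed
  \<comment> \<open>The edge \<open>a b\<close> and the two friendships of \<open>q\<close> count 4;
    \<open>q\<close> is \<open>X\<close>-adjacent to at most one of \<open>a\<close>,
    \<open>b\<close>, which adds 2.\<close>
  also have "sum ?h ?W \<le> 6"
    using dist ab q nG no_triangle[of q] by (auto simp: of_bool_def X_sym G_sym)
  also have "card (?U a \<union> ?U b) \<le> 2"
  proof -

    \<comment> \<open>Two exceptional vertices befriended with the same one of \<open>a\<close>,
      \<open>b\<close> would allow a swap sequence, so each of the two sets has at most one
      element.\<close>
    have "\<not> (X a t \<and> X b t \<and> X q t \<and> G a t \<and> X a t' \<and> X b t' \<and> X q t' \<and> G a t')"
      if "distinct [a, b, q, t, t']" for t t'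
      by (rule not_swaps[of _ "[q, t, t']"
          "[(0,3), (2,3), (1,3), (2,4), (0,4), (0,1), (0,3), (1,4), (2,4), (2,3),
          (1,3)]"])
        (use ab q that in \<open>simp_all add: X_sym G_sym\<close>)
    then have eq_a: "t = t'" if "t \<in> ?U a" "t' \<in> ?U a" for t t'
      using that dist by fastforce
    have card_a: "card (?U a) \<le> 1"
      by (rule card_le_1I[OF _ eq_a]) (simp add: finV)
    have "\<not> (X a t \<and> X b t \<and> X q t \<and> G b t \<and> X a t' \<and> X b t' \<and> X q t' \<and> G b t')"
      if "distinct [a, b, q, t, t']" for t t'
      by (rule not_swaps[of _ "[q, t, t']"
          "[(1,3), (2,3), (0,3), (2,4), (0,4), (0,1), (1,4), (1,3), (2,4), (2,3),
          (0,3)]"])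
        (use ab q that in \<open>simp_all add: X_sym G_sym\<close>)
    then have eq_b: "t = t'" if "t \<in> ?U b" "t' \<in> ?U b" for t t'
      using that dist by fastforce
    have card_b: "card (?U b) \<le> 1"
      by (rule card_le_1I[OF _ eq_b]) (simp add: finV)
    show ?thesis using card_Un_le[of "?U a" "?U b"] card_a card_b by linarith
  qed
  also have "card ?W = 3" using dist by simp
  \<comment> \<open>The upper bound is
    \<open>6 + 3 * (card V - 3) + 2 = 3 * card V - 1\<close>.\<close>
  finally show False using de_ge V_ge by linarith
qed

end

section \<open>From local exchanges to connectivity\<close>

abbreviation FS_reachable ::
  "'a pair_pre_digraph \<Rightarrow> 'b pair_pre_digraph \<Rightarrow> (('a \<Rightarrow> 'b) \<times> ('a \<Rightarrow> 'b)) set" where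
  "FS_reachable X Y \<equiv> rtrancl_on (bijections (pverts X) (pverts Y)) (parcs (FS X Y))"

lemma comp_transpose_in_bijections:
  assumes "\<sigma> \<in> bijections A B" "s \<in> A" "t \<in> A"
  shows "\<sigma> \<circ> transpose s t \<in> bijections A B"
proof -
  have "bij_betw (transpose s t) A A"
    using assms(2,3) by (intro bij_betw_byWitness[where f' = "transpose s t"]) (auto simp: transpose_def)
  then have "bij_betw (\<sigma> \<circ> transpose s t) A B"
    using assms(1) bij_betw_trans by (auto simp: bijections_def)
  moreover have "\<sigma> \<circ> transpose s t \<in> extensional A"
    using assms by (auto simp: bijections_def extensional_def transpose_def)
  ultimately show ?thesis by (simp add: bijections_def)
qed

lemma pair_graph_facts:
  assumes "pair_graph X"
  shows "finite (pverts X)" "(s, t) \<in> parcs X \<longleftrightarrow> (t, s) \<in> parcs X" "(s, s) \<notin> parcs X"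
    "(s, t) \<in> parcs X \<Longrightarrow> s \<in> pverts X" "(s, t) \<in> parcs X \<Longrightarrow> t \<in> pverts X"
    "s \<in> pverts X \<Longrightarrow> min_degree X \<le> card {t \<in> pverts X. (s, t) \<in> parcs X}"
proof -
  interpret pair_graph X by fact
  show "finite (pverts X)" by simp
  show "(s, t) \<in> parcs X \<longleftrightarrow> (t, s) \<in> parcs X"
    using pair_sym_arcs by (auto simp: symmetric_def dest: symD)
  show "(s, s) \<notin> parcs X" using pair_no_loops by fastforce
  show in_s: "s \<in> pverts X" if "(s, t) \<in> parcs X" for s t
    using arc_fst_in_verts[OF that] by simp
  show in_t: "t \<in> pverts X" if "(s, t) \<in> parcs X" for s t
    using arc_snd_in_verts[OF that] by simp
  assume "s \<in> pverts X"
  then have "min_degree X \<le> out_degree (with_proj X) s"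
    unfolding min_degree_def by (intro Min_le) auto
  also have "out_arcs (with_proj X) s = Pair s ` {t \<in> pverts X. (s, t) \<in> parcs X}"
    using in_t by (force simp: out_arcs_def)
  then have "out_degree (with_proj X) s = card {t \<in> pverts X. (s, t) \<in> parcs X}"
    unfolding out_degree_def by (simp add: card_image inj_on_def)
  finally show "min_degree X \<le> card {t \<in> pverts X. (s, t) \<in> parcs X}" .
qed

lemma FS_swap:
  assumes X: "pair_graph X" and "\<rho> \<in> bijections (pverts X) (pverts Y)"
    and "(s, t) \<in> parcs X" "(\<rho> s, \<rho> t) \<in> parcs Y"
  shows "\<rho> \<circ> transpose s t \<in> bijections (pverts X) (pverts Y)"
    and "(\<rho>, \<rho> \<circ> transpose s t) \<in> parcs (FS X Y)"
proof -
  have st: "s \<in> pverts X" "t \<in> pverts X" "s \<noteq> t"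
    using pair_graph_facts[OF X] assms(3) by metis+
  show in_B: "\<rho> \<circ> transpose s t \<in> bijections (pverts X) (pverts Y)"
    by (rule comp_transpose_in_bijections[OF assms(2) st(1,2)])
  have "FS_adj X Y \<rho> (\<rho> \<circ> transpose s t)"
    unfolding FS_adj_def using st assms(3,4) by (intro bexI[of _ s] bexI[of _ t]) auto
  then show "(\<rho>, \<rho> \<circ> transpose s t) \<in> parcs (FS X Y)"
    using assms(2) in_B by (simp add: FS_def)
qed

text \<open>Transpositions along edges of \<open>X\<close> come from the local argument, all others
  by conjugation through a common \<open>X\<close>-neighbour; with them \<open>\<sigma>\<close> is
  sorted into \<open>\<tau>\<close>. The factor 3 sits on \<open>X\<close>, so this settles one of
  two cases.\<close>

lemma FS_reachable_if_min_degree_ge: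
  assumes X: "pair_graph X" and Y: "pair_graph Y"
    and cards: "card (pverts X) = n" "card (pverts Y) = n" and n: "6 \<le> n"
    and deg: "n < 2 * min_degree X" "n < 2 * min_degree Y"
      "3 * n \<le> 3 * min_degree X + 2 * min_degree Y"
    and \<sigma>: "\<sigma> \<in> bijections (pverts X) (pverts Y)" and \<tau>: "\<tau> \<in> bijections (pverts X) (pverts Y)"
  shows "(\<sigma>, \<tau>) \<in> FS_reachable X Y"
proof -
  note X_facts = pair_graph_facts[OF X] and Y_facts = pair_graph_facts[OF Y]
  let ?V = "pverts X"
  let ?B = "bijections ?V (pverts Y)"
  define E where "E = (\<lambda>s t. (s, t) \<in> parcs X)"
  have swap_edge: "(\<sigma>, \<sigma> \<circ> transpose a b) \<in> FS_reachable X Y"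
    if \<sigma>: "\<sigma> \<in> ?B" and ab: "E a b" for \<sigma> a b
  proof -
    \<comment> \<open>Membership in \<open>?V\<close> is required explicitly because
      \<open>\<sigma>\<close> takes the value \<open>undefined\<close> elsewhere, which may itself
      be a vertex of \<open>Y\<close>.\<close>
    define G where "G = (\<lambda>s t. s \<in> ?V \<and> t \<in> ?V \<and> (\<sigma> s, \<sigma> t) \<in> parcs Y)"
    have bij: "bij_betw \<sigma> ?V (pverts Y)" using \<sigma> by (simp add: bijections_def)
    have "dense_graphs ?V E G (min_degree X) (min_degree Y)"
    proof
      fix s assume s: "s \<in> ?V"
      have "\<sigma> ` {t \<in> ?V. G s t} = {y \<in> pverts Y. (\<sigma> s, y) \<in> parcs Y}"
        using bij s by (auto simp: G_def bij_betw_def)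
      moreover have "inj_on \<sigma> {t \<in> ?V. G s t}"
        using bij by (auto simp: bij_betw_def inj_on_def)
      ultimately have "card {t \<in> ?V. G s t} = card {y \<in> pverts Y. (\<sigma> s, y) \<in> parcs Y}"
        by (metis card_image)
      then show "min_degree Y \<le> card {t \<in> ?V. G s t}"
        using Y_facts(6) s bij bij_betwE by fastforce
    qed (use X_facts Y_facts cards n deg in \<open>auto simp: E_def G_def\<close>)
    then have "reach E G (transpose a b)"
      using ab by (rule dense_graphs.reach_if_X_edge)
    \<comment> \<open>Composing with \<open>\<sigma>\<close> replaces names by actual persons:
      \<open>G (\<pi> s) (\<pi> t)\<close> says that the persons at \<open>s\<close> and
      \<open>t\<close> under \<open>\<sigma> \<circ> \<pi>\<close> are friends.\<close>
    moreover have "\<sigma> \<circ> \<pi> \<in> ?B \<and> (\<sigma>, \<sigma> \<circ> \<pi>) \<in> FS_reachable X Y" if "reach E G \<pi>" for \<pi>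
      using that
    proof induction
      case reach_id
      then show ?case using \<sigma> by simp
    next
      case (reach_swap \<pi> s t)
      have st: "(s, t) \<in> parcs X" "((\<sigma> \<circ> \<pi>) s, (\<sigma> \<circ> \<pi>) t) \<in> parcs Y"
        using reach_swap.hyps by (simp_all add: E_def G_def)
      note step = FS_swap[OF X conjunct1[OF reach_swap.IH] st]
      show ?case
        unfolding comp_assoc[symmetric]
        using step(1) rtrancl_on_into_rtrancl_on[OF conjunct2[OF reach_swap.IH] step(2,1)] by (rule conjI)
    qed
    ultimately show ?thesis by blast
  qed
  have E_in: "a \<in> ?V" "b \<in> ?V" if "E a b" for a b
    using that X_facts by (auto simp: E_def)
  have swap: "(\<sigma>, \<sigma> \<circ> transpose a b) \<in> FS_reachable X Y"
    if \<sigma>: "\<sigma> \<in> ?B" and ab: "a \<in> ?V" "b \<in> ?V" "a \<noteq> b" for \<sigma> a b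
  proof (cases "E a b")
    case True
    then show ?thesis using swap_edge \<sigma> by blast
  next
    case False
    have "{t \<in> ?V. E a t} \<inter> {t \<in> ?V. E b t} \<noteq> {}"
    proof
      assume "{t \<in> ?V. E a t} \<inter> {t \<in> ?V. E b t} = {}"
      then have "card {t \<in> ?V. E a t} + card {t \<in> ?V. E b t} =
          card ({t \<in> ?V. E a t} \<union> {t \<in> ?V. E b t})"
        using X_facts(1) by (simp add: card_Un_disjoint)
      also have "\<dots> \<le> card ?V" using X_facts(1) by (intro card_mono) auto
      finally show False
        using X_facts(6)[OF ab(1)] X_facts(6)[OF ab(2)] deg(1) cards(1) by (simp add: E_def)
    qed
    then obtain c where c: "E a c" "E b c" by auto
    have "c \<noteq> a" "c \<noteq> b" using c X_facts(3) by (auto simp: E_def)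
    then have eq: "transpose a b = transpose a c \<circ> transpose b c \<circ> transpose a c"
      using ab(3) by (auto simp: fun_eq_iff transpose_def)
    let ?\<sigma>1 = "\<sigma> \<circ> transpose a c"
    let ?\<sigma>2 = "?\<sigma>1 \<circ> transpose b c"
    have "?\<sigma>1 \<in> ?B" "?\<sigma>2 \<in> ?B"
      using \<sigma> E_in[OF c(1)] E_in[OF c(2)] by (simp_all add: comp_transpose_in_bijections)
    then have "(\<sigma>, ?\<sigma>1) \<in> FS_reachable X Y" "(?\<sigma>1, ?\<sigma>2) \<in> FS_reachable X Y"
      "(?\<sigma>2, ?\<sigma>2 \<circ> transpose a c) \<in> FS_reachable X Y"
      using \<sigma> c by (simp_all add: swap_edge)
    then have "(\<sigma>, ?\<sigma>2 \<circ> transpose a c) \<in> FS_reachable X Y"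
      by (meson rtrancl_on_trans)
    then show ?thesis by (simp add: eq comp_assoc)
  qed
  show ?thesis using \<sigma>
  proof (induction "card {v \<in> ?V. \<sigma> v \<noteq> \<tau> v}" arbitrary: \<sigma> rule: less_induct)
    case less
    have ext: "\<sigma> \<in> extensional ?V" "\<tau> \<in> extensional ?V"
      and bij: "bij_betw \<sigma> ?V (pverts Y)" "bij_betw \<tau> ?V (pverts Y)"
      using less.prems \<tau> by (auto simp: bijections_def)
    show ?case
    proof (cases "\<forall>v\<in>?V. \<sigma> v = \<tau> v")
      case True
      then have "\<sigma> = \<tau>" using ext by (auto intro: extensionalityI)
      then show ?thesis using less.prems by simp
    next
      case False
      then obtain v where v: "v \<in> ?V" "\<sigma> v \<noteq> \<tau> v" by blast
      then have "\<tau> v \<in> \<sigma> ` ?V" using bij by (auto simp: bij_betw_def)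
      then obtain w where w: "w \<in> ?V" "\<sigma> w = \<tau> v" by (metis imageE)
      have "w \<noteq> v" using v w by auto
      then have w': "\<sigma> w \<noteq> \<tau> w" using w v bij(2) by (metis bij_betw_imp_inj_on inj_onD)
      let ?\<sigma> = "\<sigma> \<circ> transpose v w"
      \<comment> \<open>The swap makes \<open>v\<close> correct, and \<open>w\<close> was already
        wrong, so no new disagreement arises.\<close>
      have "{u \<in> ?V. ?\<sigma> u \<noteq> \<tau> u} \<subseteq> {u \<in> ?V. \<sigma> u \<noteq> \<tau> u} - {v}"
        using v w w' by (auto simp: transpose_def split: if_splits)
      also have "\<dots> \<subset> {u \<in> ?V. \<sigma> u \<noteq> \<tau> u}" using v by auto
      finally have "card {u \<in> ?V. ?\<sigma> u \<noteq> \<tau> u} < card {u \<in> ?V. \<sigma> u \<noteq> \<tau> u}"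
        using X_facts(1) by (intro psubset_card_mono) auto
      moreover have in_B: "?\<sigma> \<in> ?B" using less.prems v(1) w(1) by (rule comp_transpose_in_bijections)
      ultimately have "(?\<sigma>, \<tau>) \<in> FS_reachable X Y" using less.hyps by blast
      moreover have "(\<sigma>, ?\<sigma>) \<in> FS_reachable X Y" using swap less.prems v w \<open>w \<noteq> v\<close> by simp
      ultimately show ?thesis by (meson rtrancl_on_trans)
    qed
  qed
qed

section \<open>Exchanging the two graphs by inverting bijections\<close>

definition bijection_inv :: "'a set \<Rightarrow> 'b set \<Rightarrow> ('a \<Rightarrow> 'b) \<Rightarrow> 'b \<Rightarrow> 'a" where
  "bijection_inv A B \<sigma> = restrict (inv_into A \<sigma>) B"

lemma bijection_inv_apply:
  assumes "\<sigma> \<in> bijections A B" "a \<in> A"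
  shows "bijection_inv A B \<sigma> (\<sigma> a) = a"
  using assms by (auto simp: bijection_inv_def bijections_def bij_betw_def)

lemma bijection_inv_in_bijections:
  assumes "\<sigma> \<in> bijections A B"
  shows "bijection_inv A B \<sigma> \<in> bijections B A"
  using assms bij_betw_inv_into[of \<sigma> A B]
  by (simp add: bijection_inv_def bijections_def bij_betw_restrict_eq)

lemma bijection_inv_inv:
  assumes "\<sigma> \<in> bijections A B"
  shows "bijection_inv B A (bijection_inv A B \<sigma>) = \<sigma>"
proof (rule extensionalityI[of _ A])
  fix a assume "a \<in> A"
  then have "\<sigma> a \<in> B" "bijection_inv A B \<sigma> (\<sigma> a) = a"
    using assms bijection_inv_apply[OF assms] by (auto simp: bijections_def bij_betw_apply)
  then show "bijection_inv B A (bijection_inv A B \<sigma>) a = \<sigma> a"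
    using bijection_inv_apply[OF bijection_inv_in_bijections[OF assms], of "\<sigma> a"] by simp
qed (use assms in \<open>auto simp: bijection_inv_def bijections_def\<close>)

text \<open>Adjacency of positions and friendship of persons enter a swap symmetrically, and
  inversion exchanges the two roles: the positions \<open>a\<close>, \<open>b\<close> give way to
  the persons \<open>\<sigma> a\<close>, \<open>\<sigma> b\<close>.\<close>

lemma FS_arc_inv:
  assumes Y: "pair_graph Y" and "(\<sigma>, \<tau>) \<in> parcs (FS X Y)"
  shows "(bijection_inv (pverts X) (pverts Y) \<sigma>, bijection_inv (pverts X) (pverts Y) \<tau>) \<in> parcs (FS Y X)"
proof -
  have B: "\<sigma> \<in> bijections (pverts X) (pverts Y)" "\<tau> \<in> bijections (pverts X) (pverts Y)"
    and "FS_adj X Y \<sigma> \<tau>"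
    using assms(2) by (auto simp: FS_def)
  then obtain a b where ab: "a \<in> pverts X" "b \<in> pverts X" "a \<noteq> b" "(a, b) \<in> parcs X"
    "(\<sigma> a, \<sigma> b) \<in> parcs Y" "\<tau> a = \<sigma> b" "\<tau> b = \<sigma> a" "\<forall>w \<in> pverts X - {a, b}. \<tau> w = \<sigma> w"
    unfolding FS_adj_def by blast
  let ?i = "bijection_inv (pverts X) (pverts Y)"
  have inv: "?i \<sigma> (\<sigma> u) = u" "?i \<tau> (\<tau> u) = u" if "u \<in> pverts X" for u
    using bijection_inv_apply B that by metis+
  have "?i \<tau> y = ?i \<sigma> y" if y: "y \<in> pverts Y - {\<sigma> a, \<sigma> b}" for y
  proof -
    have "y \<in> \<sigma> ` pverts X"
      using y B(1) by (simp add: bijections_def bij_betw_def)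
    then obtain u where u: "u \<in> pverts X" "\<sigma> u = y" by blast
    then have "\<tau> u = y" using ab(8) y by blast
    then show ?thesis using u inv by metis
  qed
  moreover have "\<sigma> a \<in> pverts Y" "\<sigma> b \<in> pverts Y" "\<sigma> a \<noteq> \<sigma> b"
    using ab(5) pair_graph_facts[OF Y] by metis+
  moreover have "?i \<sigma> (\<sigma> a) = a" "?i \<sigma> (\<sigma> b) = b" "?i \<tau> (\<sigma> a) = b" "?i \<tau> (\<sigma> b) = a"
    using inv ab by metis+
  ultimately have "FS_adj Y X (?i \<sigma>) (?i \<tau>)"
    unfolding FS_adj_def using ab by (intro bexI[of _ "\<sigma> a"] bexI[of _ "\<sigma> b"]) auto
  then show ?thesis
    using B bijection_inv_in_bijections by (auto simp: FS_def)
qed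

lemma FS_reachable_inv:
  assumes Y: "pair_graph Y" and "(\<sigma>, \<tau>) \<in> FS_reachable X Y"
  shows "(bijection_inv (pverts X) (pverts Y) \<sigma>, bijection_inv (pverts X) (pverts Y) \<tau>) \<in> FS_reachable Y X"
  using assms(2)
proof (induction rule: rtrancl_on.induct)
  case (rtrancl_on_refl \<sigma>)
  then show ?case using bijection_inv_in_bijections by auto
next
  case (rtrancl_on_into_rtrancl_on \<sigma> \<tau> \<rho>)
  then show ?case
    using FS_arc_inv[OF Y] bijection_inv_in_bijections rtrancl_on.rtrancl_on_into_rtrancl_on by metis
qed

theorem theorem1p4:
  fixes X :: "'a pair_pre_digraph" and Y :: "'b pair_pre_digraph" and n :: nat
  assumes "pair_graph X" and "pair_graph Y"
    and "card (pverts X) = n" and "card (pverts Y) = n" and "n \<ge> 6"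
    and "real (min_degree X) > real n / 2" and "real (min_degree Y) > real n / 2"
    and "2 * min (min_degree X) (min_degree Y) + 3 * max (min_degree X) (min_degree Y) \<ge> 3 * n"
  shows "Digraph_Component.connected (with_proj (FS X Y))"
proof -
  let ?B = "bijections (pverts X) (pverts Y)"
  have gt: "n < 2 * min_degree X" "n < 2 * min_degree Y"
    using assms(6,7) by linarith+
  have ge: "3 * n \<le> 3 * k + 2 * l" if "l \<le> k" "2 * min k l + 3 * max k l \<ge> 3 * n" for k l :: nat
    using that by (simp add: min.absorb2 max.absorb1)
  have reachable: "(\<sigma>, \<tau>) \<in> FS_reachable X Y" if \<sigma>: "\<sigma> \<in> ?B" and \<tau>: "\<tau> \<in> ?B" for \<sigma> \<tau>
  proof (cases "min_degree Y \<le> min_degree X")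
    case True
    then show ?thesis
      using FS_reachable_if_min_degree_ge[OF assms(1-5) gt _ \<sigma> \<tau>] ge assms(8) by blast
  next
    case False
    \<comment> \<open>Here \<open>Y\<close> has the larger minimum degree, so a walk is found in
      \<open>FS Y X\<close> between the inverses and inverted back.\<close>
    let ?i = "bijection_inv (pverts X) (pverts Y)"
    have "(?i \<sigma>, ?i \<tau>) \<in> FS_reachable Y X"
      using FS_reachable_if_min_degree_ge[OF assms(2,1,4,3,5) gt(2,1) _
          bijection_inv_in_bijections[OF \<sigma>] bijection_inv_in_bijections[OF \<tau>]]
        ge[of "min_degree X" "min_degree Y"] assms(8) False
      by (simp add: min.commute max.commute)
    from FS_reachable_inv[OF assms(1) this] show ?thesis
      by (simp add: bijection_inv_inv \<sigma> \<tau>)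
  qed
  \<comment> \<open>Connectedness includes having a vertex; equal cardinalities provide a bijection,
    which is restricted to make it extensional.\<close>
  have "finite (pverts X)" "finite (pverts Y)"
    using assms(1,2) pair_graph_facts(1) by blast+
  then obtain \<sigma> where "bij_betw \<sigma> (pverts X) (pverts Y)"
    using finite_same_card_bij assms(3,4) by metis
  then have "restrict \<sigma> (pverts X) \<in> ?B"
    by (simp add: bijections_def bij_betw_restrict_eq)
  then have "pverts (FS X Y) \<noteq> {}" by (auto simp: FS_def)
  \<comment> \<open>Connectedness is stated through the symmetric closure, which contains the arcs
    already used.\<close>
  moreover have "(\<sigma>, \<tau>) \<in> rtrancl_on (pverts (FS X Y)) ((parcs (FS X Y))\<^sup>s)"
    if "\<sigma> \<in> pverts (FS X Y)" "\<tau> \<in> pverts (FS X Y)" for \<sigma> \<tau>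
  proof -
    have "pverts (FS X Y) = ?B" by (simp add: FS_def)
    then have "(\<sigma>, \<tau>) \<in> rtrancl_on (pverts (FS X Y)) (parcs (FS X Y))"
      using that reachable by simp
    then show ?thesis by (rule rtrancl_on_mono[rotated -1]) (auto simp: symcl_def)
  qed
  ultimately show ?thesis by (simp add: connected_conv)
qed

end
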